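(* Let $k\ge\ell\ge2$ be integers. Then $\tau(\mathrm{T}(K_k))\le\tau(\mathrm{T}(K_\ell))$, where $K_m$ denotes the complete graph on $m$ vertices.
   Context: $b_1,\dots,b_n$ is the standard basis of $\mathbb{C}^n$ and $[n]=\{1,\dots,n\}$. Products of $k$-tensors are regarded as $k$-tensors (legs grouped position by position). Let $\mathrm{T}=\sum_{i=1}^2b_i^{\otimes k}\in(\mathbb{C}^2)^{\otimes k}$, where $k$ is the order of the tensor under consideration. For $\phi\in U_1\otimes\cdots\otimes U_k$, $\psi\in V_1\otimes\cdots\otimes V_k$ (finite-dimensional complex spaces), $\phi\ge\psi$ if there are linear maps $A_i:U_i\to V_i$ with $\psi=(A_1\otimes\cdots\otimes A_k)\phi$. The exponent of a $k$-tensor $\psi$ is $\omega(\psi)=\lim_{n\to\infty}\frac1n\min\{m\in\mathbb{N}\mid\mathrm{T}^{\otimes m}\ge\psi^{\otimes n}\}$ (the limit exists). For a finite simple graph $G=(V,E)$, $\mathrm{T}_n(G)=\sum_{i\in[n]^E}\bigotimes_{v\in V}\bigl(\bigotimes_{e\in E:\,v\in e}b_{i_e}\bigr)$, a $|V|$-tensor (one leg for each vertex); $\mathrm{T}(G)=\mathrm{T}_2(G)$; the exponent per edge is $\tau(\mathrm{T}(G))=\omega(\mathrm{T}(G))/|E|$. *)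

theory Defs
  imports Complex_Main "HOL-Library.FuncSet" "HOL-Library.Ramsey"
begin

text \<open>
  A tensor in the tensor product over the legs \<open>v\<close> of the spaces of complex vectors indexed by the
  (finite) set \<open>idx v\<close>, given by its coordinates in the product basis. The basis of the product is
  \<open>PiE legs idx\<close>; the values of \<open>coeff\<close> outside this set carry no meaning. A tensor of order \<open>k\<close>
  is one with \<open>k\<close> legs.
\<close>

record ('v, 'i) tensor =
  legs :: "'v set"
  idx :: "'v \<Rightarrow> 'i set"
  coeff :: "('v \<Rightarrow> 'i) \<Rightarrow> complex"

definition tensor_basis :: "('v, 'i) tensor \<Rightarrow> ('v \<Rightarrow> 'i) set" where
  "tensor_basis \<phi> = PiE (legs \<phi>) (idx \<phi>)"

text \<open>
  \<open>\<phi> \<ge> \<psi>\<close>: the linear map on leg \<open>v\<close> is the matrix \<open>A v\<close>, with the row index (a basis index of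
  \<open>\<psi>\<close>) first and the column index (a basis index of \<open>\<phi>\<close>) second.
\<close>

definition restricts_to :: "('v, 'i) tensor \<Rightarrow> ('v, 'j) tensor \<Rightarrow> bool" where
  "restricts_to \<phi> \<psi> \<longleftrightarrow> legs \<phi> = legs \<psi> \<and>
     (\<exists>A :: 'v \<Rightarrow> 'j \<Rightarrow> 'i \<Rightarrow> complex. \<forall>y\<in>tensor_basis \<psi>.
        coeff \<psi> y = (\<Sum>x\<in>tensor_basis \<phi>. (\<Prod>v\<in>legs \<phi>. A v (y v) (x v)) * coeff \<phi> x))"

text \<open>
  The \<open>n\<close>-th tensor power with the legs grouped position by position: a basis index on leg \<open>v\<close> is
  an \<open>n\<close>-tuple of basis indices of \<open>\<phi>\<close> on \<open>v\<close>. For \<open>n = 0\<close> this is the scalar \<open>1\<close>.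
\<close>

definition tensor_power :: "('v, 'i) tensor \<Rightarrow> nat \<Rightarrow> ('v, nat \<Rightarrow> 'i) tensor" where
  "tensor_power \<phi> n =
     \<lparr>legs = legs \<phi>,
      idx = (\<lambda>v. PiE {..<n} (\<lambda>_. idx \<phi> v)),
      coeff = (\<lambda>x. \<Prod>r<n. coeff \<phi> (\<lambda>v\<in>legs \<phi>. x v r))\<rparr>"

definition basis_vec :: "'i \<Rightarrow> 'i \<Rightarrow> complex" where
  "basis_vec i = (\<lambda>j. if j = i then 1 else 0)"

text \<open>The tensor \<open>T\<close>, with one leg for each element of \<open>V\<close>.\<close>

definition unit_tensor :: "'v set \<Rightarrow> ('v, nat) tensor" where
  "unit_tensor V =
     \<lparr>legs = V,
      idx = (\<lambda>_. {1..2}),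
      coeff = (\<lambda>x. \<Sum>i\<in>{1..2}. \<Prod>v\<in>V. basis_vec i (x v))\<rparr>"

definition tensor_exponent :: "('v, 'i) tensor \<Rightarrow> real" where
  "tensor_exponent \<psi> =
     lim (\<lambda>n. real (LEAST m. restricts_to (tensor_power (unit_tensor (legs \<psi>)) m) (tensor_power \<psi> n))
              / real n)"

text \<open>A graph is the pair of its vertex set and its edge set, an edge being a two-element set.\<close>

type_synonym 'v graph = "'v set \<times> 'v set set"

definition finite_simple_graph :: "'v graph \<Rightarrow> bool" where
  "finite_simple_graph G \<longleftrightarrow> finite (fst G) \<and> snd G \<subseteq> nsets (fst G) 2"

definition incident_edges :: "'v graph \<Rightarrow> 'v \<Rightarrow> 'v set set" where
  "incident_edges G v = {e \<in> snd G. v \<in> e}"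

definition complete_graph :: "nat \<Rightarrow> nat graph" where
  "complete_graph m = ({1..m}, nsets {1..m} 2)"

lemma finite_simple_graph_complete_graph: "finite_simple_graph (complete_graph m)"
  by (simp add: finite_simple_graph_def complete_graph_def)

text \<open>
  The space on leg \<open>v\<close> is the tensor product of one copy of the \<open>n\<close>-dimensional space for each edge
  at \<open>v\<close>, so its basis is indexed by the labellings of the edges at \<open>v\<close> by \<open>{1..n}\<close>.
\<close>

definition graph_tensor :: "nat \<Rightarrow> 'v graph \<Rightarrow> ('v, 'v set \<Rightarrow> nat) tensor" where
  "graph_tensor n G =
     \<lparr>legs = fst G,
      idx = (\<lambda>v. PiE (incident_edges G v) (\<lambda>_. {1..n})),
      coeff = (\<lambda>x. \<Sum>i\<in>PiE (snd G) (\<lambda>_. {1..n}).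
                 \<Prod>v\<in>fst G. \<Prod>e\<in>incident_edges G v. basis_vec (i e) (x v e))\<rparr>"

definition exponent_per_edge :: "'v graph \<Rightarrow> real" where
  "exponent_per_edge G = tensor_exponent (graph_tensor 2 G) / real (card (snd G))"

end

theory Submission
  imports Defs
begin

text \<open>
  Cover the edges of \<open>K\<^sub>k\<close> by the copies of \<open>K\<^sub>l\<close> on the \<open>l\<close>-element vertex sets \<open>S\<close>. Every edge
  lies in exactly \<open>c = (k - 2) choose (l - 2)\<close> of these sets, and a graph tensor is a product of one
  factor per edge, so \<open>T(K\<^sub>k)\<close> to the power \<open>c N\<close> is the product over all \<open>S\<close> of \<open>T(K\<^sub>l)\<close> to the
  power \<open>N\<close> placed on the legs in \<open>S\<close> (\<open>rank_complete_graph_from_cliques\<close>). If \<open>m\<close> copies of \<open>T\<close>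
  suffice for each of the \<open>k choose l\<close> factors, then \<open>m (k choose l)\<close> copies suffice for the product.
  Dividing by \<open>c N\<close> and letting \<open>N\<close> grow gives \<open>\<omega>(T(K\<^sub>k)) \<le> (k choose l) / c * \<omega>(T(K\<^sub>l))\<close>, and
  double counting of the pairs of an edge and an \<open>l\<close>-set containing it,
  \<open>(k choose l) (l choose 2) = (k choose 2) c\<close>, turns this into the inequality per edge.

  Restriction from a power of \<open>T\<close> is handled through sums of product tensors: \<open>T\<close> to the power \<open>m\<close> is
  the diagonal tensor of size \<open>2 ^ m\<close>, so it restricts to \<open>\<psi>\<close> iff \<open>\<psi>\<close> is a sum of \<open>2 ^ m\<close> product
  tensors (\<open>restricts_to_unit_power_iff\<close>). The numbers of summands multiply when
  tensors on possibly different subsets of the legs are multiplied (\<open>rank_at_most_prod\<close>).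
  This one fact yields the clique bound above, the existence of some \<open>m\<close> for every power of \<open>\<psi>\<close>, and
  the subadditivity of the least \<open>m\<close> in the exponent. By subadditivity the limit defining the exponent
  exists, and so it can be computed along the multiples of \<open>c\<close>.
\<close>

section \<open>Subadditive sequences\<close>

text \<open>
  Fekete's lemma: division with remainder by a fixed \<open>p\<close> bounds \<open>f n / n\<close> by \<open>f p / p\<close> up to an error
  of order \<open>1 / n\<close>, so the sequence converges to the infimum of its terms.
\<close>

lemma subadditive_convergent:
  fixes f :: "nat \<Rightarrow> real"
  assumes sub: "\<And>m n. f (m + n) \<le> f m + f n" and nonneg: "\<And>n. 0 \<le> f n"
  shows "convergent (\<lambda>n. f n / real n)"
proof -
  define L where "L = (INF n\<in>{1..}. f n / real n)"
  have bdd: "bdd_below ((\<lambda>n. f n / real n) ` {1..})"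
    by (rule bdd_belowI[of _ 0]) (auto simp: nonneg)
  have lower: "L \<le> f n / real n" if "n \<ge> 1" for n
    unfolding L_def using that by (intro cINF_lower[OF bdd]) auto
  have mult: "f (q * p + r) \<le> real q * f p + f r" for q p r
  proof (induction q)
    case (Suc q)
    have "f (Suc q * p + r) = f (p + (q * p + r))" by (simp add: add.assoc)
    also have "\<dots> \<le> f p + f (q * p + r)" by (rule sub)
    finally show ?case using Suc by (simp add: algebra_simps)
  qed simp
  have "(\<lambda>n. f n / real n) \<longlonglongrightarrow> L"
  proof (rule order_tendstoI)
    fix a assume "a < L"
    then show "eventually (\<lambda>n. a < f n / real n) sequentially"
      using lower by (intro eventually_sequentiallyI[of 1]) (meson less_le_trans)
  next
    fix a assume "L < a"
    then obtain p where p: "p \<ge> 1" "f p / real p < a"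
      unfolding L_def using cINF_less_iff[OF _ bdd] by auto
    define M where "M = (\<Sum>i<p. f i)"
    have upper: "f n / real n \<le> f p / real p + M / real n" if "n \<ge> 1" for n
    proof -
      have "f n \<le> real (n div p) * f p + f (n mod p)"
        using mult[of "n div p" p "n mod p"] by simp
      also have "f (n mod p) \<le> M"
        unfolding M_def using p by (intro member_le_sum) (auto simp: nonneg)
      also have "real (n div p) * f p \<le> real n / real p * f p"
        by (intro mult_right_mono of_nat_div_le_of_nat nonneg)
      finally show ?thesis using that p by (simp add: field_simps)
    qed
    have "(\<lambda>n. f p / real p + M / real n) \<longlonglongrightarrow> f p / real p + 0"
      by (intro tendsto_intros lim_const_over_n)
    then have "eventually (\<lambda>n. f p / real p + M / real n < a) sequentially"
      using p by (intro order_tendstoD) auto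
    then show "eventually (\<lambda>n. f n / real n < a) sequentially"
      using eventually_ge_at_top[of 1] by eventually_elim (use upper in force)
  qed
  then show ?thesis by (auto simp: convergent_def)
qed

section \<open>Sums of product tensors\<close>

text \<open>
  The number of product tensors is fixed to be \<open>r\<close>, but some may vanish, so for a nonempty set of legs
  this is the usual bound on the tensor rank.
\<close>

definition rank_at_most :: "('v, 'i) tensor \<Rightarrow> nat \<Rightarrow> bool" where
  "rank_at_most \<psi> r \<longleftrightarrow>
     (\<exists>A. \<forall>y\<in>tensor_basis \<psi>. coeff \<psi> y = (\<Sum>z<r. \<Prod>v\<in>legs \<psi>. A v (y v) z))"

text \<open>
  Product tensors arise indexed by functions (choices of one summand per factor, or labellings of
  edges); this reindexing lets such sets replace \<open>{..<r}\<close>.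
\<close>

lemma rank_at_most_card_iff:
  fixes Z :: "'z set"
  assumes "finite Z"
  shows "rank_at_most \<psi> (card Z) \<longleftrightarrow>
    (\<exists>A. \<forall>y\<in>tensor_basis \<psi>. coeff \<psi> y = (\<Sum>z\<in>Z. \<Prod>v\<in>legs \<psi>. A v (y v) z))"
    (is "_ \<longleftrightarrow> ?R")
proof -
  obtain h where h: "bij_betw h {..<card Z} Z"
    using ex_bij_betw_nat_finite[OF assms] by (auto simp: atLeast0LessThan)
  define g where "g = inv_into {..<card Z} h"
  have g: "bij_betw g Z {..<card Z}" unfolding g_def by (rule bij_betw_inv_into[OF h])
  show ?thesis
  proof
    assume "rank_at_most \<psi> (card Z)"
    then obtain A where A: "\<And>y. y \<in> tensor_basis \<psi> \<Longrightarrow>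
        coeff \<psi> y = (\<Sum>z<card Z. \<Prod>v\<in>legs \<psi>. A v (y v) z)"
      unfolding rank_at_most_def by blast
    have "coeff \<psi> y = (\<Sum>z\<in>Z. \<Prod>v\<in>legs \<psi>. A v (y v) (g z))" if "y \<in> tensor_basis \<psi>" for y
      unfolding A[OF that] by (rule sum.reindex_bij_betw[OF g, symmetric])
    then show ?R by (intro exI[of _ "\<lambda>v a z. A v a (g z)"]) blast
  next
    assume ?R
    then obtain A where A: "\<And>y. y \<in> tensor_basis \<psi> \<Longrightarrow>
        coeff \<psi> y = (\<Sum>z\<in>Z. \<Prod>v\<in>legs \<psi>. A v (y v) z)"
      by blast
    have "coeff \<psi> y = (\<Sum>z<card Z. \<Prod>v\<in>legs \<psi>. A v (y v) (h z))"
      if "y \<in> tensor_basis \<psi>" for y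
      unfolding A[OF that] by (rule sum.reindex_bij_betw[OF h, symmetric])
    then show "rank_at_most \<psi> (card Z)"
      unfolding rank_at_most_def by (intro exI[of _ "\<lambda>v a z. A v a (h z)"]) blast
  qed
qed

text \<open>
  Multiplying out a product of sums of product tensors gives one product tensor for each choice \<open>z\<close> of a
  summand in every factor. Each factor may live on its own legs: \<open>h j\<close> places the legs of \<open>\<phi> j\<close> among
  those of \<open>\<psi>\<close>, and \<open>g j u\<close> extracts from a basis index of \<open>\<psi>\<close> the component that \<open>\<phi> j\<close> sees on its
  leg \<open>u\<close>. On the remaining legs of \<open>\<psi>\<close> the factor is constantly \<open>1\<close>.
\<close>

lemma rank_at_most_prod:
  fixes \<phi> :: "'j \<Rightarrow> ('u, 'a) tensor" and \<psi> :: "('v, 'b) tensor"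
  assumes fin: "finite J" "finite (legs \<psi>)"
    and inj: "\<And>j. j \<in> J \<Longrightarrow> inj_on (h j) (legs (\<phi> j))"
    and legs: "\<And>j. j \<in> J \<Longrightarrow> h j ` legs (\<phi> j) \<subseteq> legs \<psi>"
    and idx: "\<And>j u a. j \<in> J \<Longrightarrow> u \<in> legs (\<phi> j) \<Longrightarrow> a \<in> idx \<psi> (h j u) \<Longrightarrow> g j u a \<in> idx (\<phi> j) u"
    and coeff: "\<And>y. y \<in> tensor_basis \<psi> \<Longrightarrow>
      coeff \<psi> y = (\<Prod>j\<in>J. coeff (\<phi> j) (\<lambda>u\<in>legs (\<phi> j). g j u (y (h j u))))"
    and rank: "\<And>j. j \<in> J \<Longrightarrow> rank_at_most (\<phi> j) (r j)"
  shows "rank_at_most \<psi> (\<Prod>j\<in>J. r j)"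
proof -
  have "\<forall>j\<in>J. \<exists>A. \<forall>x\<in>tensor_basis (\<phi> j).
      coeff (\<phi> j) x = (\<Sum>z<r j. \<Prod>u\<in>legs (\<phi> j). A u (x u) z)"
    using rank unfolding rank_at_most_def by blast
  then obtain A where A: "\<And>j x. j \<in> J \<Longrightarrow> x \<in> tensor_basis (\<phi> j) \<Longrightarrow>
      coeff (\<phi> j) x = (\<Sum>z<r j. \<Prod>u\<in>legs (\<phi> j). A j u (x u) z)"
    by metis
  define k where "k j = inv_into (legs (\<phi> j)) (h j)" for j
  define B where "B v a z =
    (\<Prod>j\<in>J. if v \<in> h j ` legs (\<phi> j) then A j (k j v) (g j (k j v) a) (z j) else 1)" for v a z
  define Z where "Z = PiE J (\<lambda>j. {..<r j})"
  have "coeff \<psi> y = (\<Sum>z\<in>Z. \<Prod>v\<in>legs \<psi>. B v (y v) z)" if y: "y \<in> tensor_basis \<psi>" for y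
  proof -
    have factor: "coeff (\<phi> j) (\<lambda>u\<in>legs (\<phi> j). g j u (y (h j u))) =
        (\<Sum>z<r j. \<Prod>v\<in>legs \<psi>. if v \<in> h j ` legs (\<phi> j) then A j (k j v) (g j (k j v) (y v)) z else 1)"
      if j: "j \<in> J" for j
    proof -
      let ?x = "\<lambda>u\<in>legs (\<phi> j). g j u (y (h j u))"
      have "?x \<in> tensor_basis (\<phi> j)"
        using y legs[OF j] idx[OF j] by (fastforce simp: tensor_basis_def PiE_iff)
      then have "coeff (\<phi> j) ?x = (\<Sum>z<r j. \<Prod>u\<in>legs (\<phi> j). A j u (g j u (y (h j u))) z)"
        using A[OF j] by simp
      also have "\<dots> = (\<Sum>z<r j. \<Prod>v\<in>h j ` legs (\<phi> j). A j (k j v) (g j (k j v) (y v)) z)"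
        by (simp add: prod.reindex inj[OF j] k_def)
      also have "\<dots> = (\<Sum>z<r j. \<Prod>v\<in>legs \<psi>.
          if v \<in> h j ` legs (\<phi> j) then A j (k j v) (g j (k j v) (y v)) z else 1)"
        using legs[OF j] by (simp add: prod.inter_restrict[symmetric] fin Int_absorb1)
      finally show ?thesis .
    qed
    have "coeff \<psi> y = (\<Prod>j\<in>J. \<Sum>z<r j. \<Prod>v\<in>legs \<psi>.
        if v \<in> h j ` legs (\<phi> j) then A j (k j v) (g j (k j v) (y v)) z else 1)"
      by (simp only: coeff[OF y] factor cong: prod.cong)
    also have "\<dots> = (\<Sum>z\<in>Z. \<Prod>j\<in>J. \<Prod>v\<in>legs \<psi>.
        if v \<in> h j ` legs (\<phi> j) then A j (k j v) (g j (k j v) (y v)) (z j) else 1)"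
      unfolding Z_def by (rule prod_sum_PiE) (use fin in auto)
    also have "\<dots> = (\<Sum>z\<in>Z. \<Prod>v\<in>legs \<psi>. B v (y v) z)"
      unfolding B_def by (intro sum.cong refl prod.swap)
    finally show ?thesis .
  qed
  then have "rank_at_most \<psi> (card Z)"
    using fin by (subst rank_at_most_card_iff) (auto simp: Z_def intro!: finite_PiE)
  then show ?thesis using fin by (simp add: Z_def card_PiE)
qed

text \<open>
  The coefficient of a power of \<open>T\<close> at \<open>x\<close> is \<open>1\<close> if all legs carry the same word \<open>z \<in> {1, 2} ^ m\<close> and
  \<open>0\<close> otherwise. Applying linear maps \<open>A v\<close> on the legs therefore produces the sum over \<open>z\<close> of the
  products of the columns of the \<open>A v\<close> at \<open>z\<close>, which is an arbitrary sum of \<open>2 ^ m\<close> product tensors.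
\<close>

lemma restricts_to_unit_power_iff:
  assumes fin: "finite (legs \<psi>)"
  shows "restricts_to (tensor_power (unit_tensor (legs \<psi>)) m) \<psi> \<longleftrightarrow> rank_at_most \<psi> (2 ^ m)"
proof -
  define V where "V = legs \<psi>"
  define Z :: "(nat \<Rightarrow> nat) set" where "Z = PiE {..<m} (\<lambda>_. {1..2})"
  let ?T = "tensor_power (unit_tensor V) m"
  have finZ: "finite Z" and cardZ: "card Z = 2 ^ m"
    unfolding Z_def by (auto intro!: finite_PiE simp: card_PiE)
  have basis: "tensor_basis ?T = PiE V (\<lambda>_. Z)"
    by (simp add: tensor_basis_def tensor_power_def unit_tensor_def Z_def)
  have coeff: "coeff ?T x = (\<Sum>z\<in>Z. \<Prod>v\<in>V. if x v = z then 1 else 0)"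
    if x: "x \<in> PiE V (\<lambda>_. Z)" for x
  proof -
    have eq: "(\<Prod>s<m. basis_vec (z s) (x v s)) = (if x v = z then 1 else 0)"
      if vz: "v \<in> V" "z \<in> Z" for v z
    proof (cases "x v = z")
      case False
      have "x v \<in> Z" using x vz by auto
      then obtain s where "s < m" "x v s \<noteq> z s"
        using False vz(2) PiE_ext[of "x v" "{..<m}" "\<lambda>_. {1..2}" z] unfolding Z_def by auto
      then have "\<exists>s\<in>{..<m}. basis_vec (z s) (x v s) = 0"
        by (auto simp: basis_vec_def)
      then show ?thesis using False by (simp add: prod_zero_iff)
    qed (simp add: basis_vec_def)
    have "coeff ?T x = (\<Prod>s<m. \<Sum>i\<in>{1..2}. \<Prod>v\<in>V. basis_vec i (x v s))"
      by (simp add: tensor_power_def unit_tensor_def)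
    also have "\<dots> = (\<Sum>z\<in>Z. \<Prod>s<m. \<Prod>v\<in>V. basis_vec (z s) (x v s))"
      unfolding Z_def by (rule prod_sum_PiE) auto
    also have "\<dots> = (\<Sum>z\<in>Z. \<Prod>v\<in>V. \<Prod>s<m. basis_vec (z s) (x v s))"
      by (intro sum.cong refl prod.swap)
    also have "\<dots> = (\<Sum>z\<in>Z. \<Prod>v\<in>V. if x v = z then 1 else 0)"
      by (intro sum.cong prod.cong refl eq)
    finally show ?thesis .
  qed
  have diag: "(\<Sum>x\<in>tensor_basis ?T. (\<Prod>v\<in>V. A v (y v) (x v)) * coeff ?T x) =
      (\<Sum>z\<in>Z. \<Prod>v\<in>V. A v (y v) z)" for A :: "'a \<Rightarrow> 'b \<Rightarrow> (nat \<Rightarrow> nat) \<Rightarrow> complex" and y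
  proof -
    have "(\<Sum>x\<in>tensor_basis ?T. (\<Prod>v\<in>V. A v (y v) (x v)) * coeff ?T x) =
        (\<Sum>x\<in>PiE V (\<lambda>_. Z). \<Sum>z\<in>Z. \<Prod>v\<in>V. A v (y v) (x v) * (if x v = z then 1 else 0))"
      unfolding basis by (intro sum.cong refl) (simp add: coeff sum_distrib_left prod.distrib)
    also have "\<dots> =
        (\<Sum>z\<in>Z. \<Sum>x\<in>PiE V (\<lambda>_. Z). \<Prod>v\<in>V. A v (y v) (x v) * (if x v = z then 1 else 0))"
      by (rule sum.swap)
    also have "\<dots> = (\<Sum>z\<in>Z. \<Prod>v\<in>V. \<Sum>t\<in>Z. A v (y v) t * (if t = z then 1 else 0))"
      by (intro sum.cong refl prod_sum_PiE[symmetric]) (use fin finZ in \<open>auto simp: V_def\<close>)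
    also have "\<dots> = (\<Sum>z\<in>Z. \<Prod>v\<in>V. A v (y v) z)"
      by (intro sum.cong prod.cong refl) (simp add: finZ if_distrib cong: if_cong)
    finally show ?thesis .
  qed
  have "legs ?T = V" by (simp add: tensor_power_def unit_tensor_def)
  then have "restricts_to ?T \<psi> \<longleftrightarrow>
      (\<exists>A. \<forall>y\<in>tensor_basis \<psi>. coeff \<psi> y = (\<Sum>z\<in>Z. \<Prod>v\<in>V. A v (y v) z))"
    by (simp add: restricts_to_def diag flip: V_def)
  also have "\<dots> \<longleftrightarrow> rank_at_most \<psi> (2 ^ m)"
    using rank_at_most_card_iff[OF finZ, of \<psi>] by (simp add: V_def cardZ)
  finally show ?thesis by (simp add: V_def)
qed

section \<open>The exponent as a limit\<close>

lemma legs_tensor_power [simp]: "legs (tensor_power \<psi> n) = legs \<psi>"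
  by (simp add: tensor_power_def)

lemma rank_at_most_power:
  assumes "finite (legs \<psi>)" "rank_at_most \<psi> r"
  shows "rank_at_most (tensor_power \<psi> n) (r ^ n)"
proof -
  have "rank_at_most (tensor_power \<psi> n) (\<Prod>s<n. r)"
    by (rule rank_at_most_prod[where \<phi> = "\<lambda>_. \<psi>" and h = "\<lambda>_ v. v" and g = "\<lambda>s v a. a s"])
       (use assms in \<open>auto simp: tensor_power_def\<close>)
  then show ?thesis by simp
qed

lemma rank_at_most_power_add:
  fixes \<psi> :: "('v, 'i) tensor"
  assumes fin: "finite (legs \<psi>)"
    and m: "rank_at_most (tensor_power \<psi> m) p" and n: "rank_at_most (tensor_power \<psi> n) q"
  shows "rank_at_most (tensor_power \<psi> (m + n)) (p * q)"
proof -
  \<comment> \<open>\<open>False\<close> stands for the first \<open>m\<close> positions, \<open>True\<close> for the last \<open>n\<close>.\<close>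
  let ?len = "\<lambda>b. if b then n else m"
  let ?off = "\<lambda>b. if b then m else 0"
  have "rank_at_most (tensor_power \<psi> (m + n)) (\<Prod>b\<in>{False, True}. if b then q else p)"
  proof (rule rank_at_most_prod[where \<phi> = "\<lambda>b. tensor_power \<psi> (?len b)" and h = "\<lambda>_ v. v"
        and g = "\<lambda>b v a. \<lambda>s\<in>{..<?len b}. a (?off b + s)"])
    fix y :: "'v \<Rightarrow> nat \<Rightarrow> 'i"
    let ?c = "\<lambda>s. coeff \<psi> (\<lambda>v\<in>legs \<psi>. y v s)"
    have "(\<Prod>s<m + n. ?c s) = (\<Prod>s<m. ?c s) * (\<Prod>s<n. ?c (m + s))"
      by (induction n) (simp_all add: mult.assoc)
    then show "coeff (tensor_power \<psi> (m + n)) y = (\<Prod>b\<in>{False, True}.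
        coeff (tensor_power \<psi> (?len b)) (\<lambda>v\<in>legs (tensor_power \<psi> (?len b)).
          \<lambda>s\<in>{..<?len b}. y v (?off b + s)))"
      by (simp add: tensor_power_def cong: restrict_cong)
  qed (use fin m n in \<open>auto simp: tensor_power_def PiE_iff\<close>)
  then show ?thesis by simp
qed

text \<open>
  By \<open>restricts_to_unit_power_iff\<close>, for finitely many legs this is the minimum in the definition of the
  exponent.
\<close>

definition log_rank :: "('v, 'i) tensor \<Rightarrow> nat \<Rightarrow> nat" where
  "log_rank \<psi> n = (LEAST m. rank_at_most (tensor_power \<psi> n) (2 ^ m))"

lemma log_rank_le: "rank_at_most (tensor_power \<psi> n) (2 ^ m) \<Longrightarrow> log_rank \<psi> n \<le> m"
  unfolding log_rank_def by (rule Least_le)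

text \<open>
  A bound on \<open>\<psi>\<close> itself makes the set of admissible exponents nonempty for every power, so the least
  one is attained.
\<close>

lemma rank_at_most_log_rank:
  assumes "finite (legs \<psi>)" "rank_at_most \<psi> (2 ^ m)"
  shows "rank_at_most (tensor_power \<psi> n) (2 ^ log_rank \<psi> n)"
  unfolding log_rank_def
  using rank_at_most_power[OF assms, of n]
  by (intro LeastI[of "\<lambda>m. rank_at_most (tensor_power \<psi> n) (2 ^ m)" "m * n"])
     (simp add: power_mult)

lemma tensor_exponent_limit:
  assumes fin: "finite (legs \<psi>)" and rank: "rank_at_most \<psi> (2 ^ m)"
  shows "(\<lambda>n. real (log_rank \<psi> n) / real n) \<longlonglongrightarrow> tensor_exponent \<psi>"
proof -
  have "log_rank \<psi> (p + q) \<le> log_rank \<psi> p + log_rank \<psi> q" for p q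
    using rank_at_most_power_add[OF fin rank_at_most_log_rank[OF assms] rank_at_most_log_rank[OF assms]]
    by (intro log_rank_le) (simp add: power_add)
  then have "convergent (\<lambda>n. real (log_rank \<psi> n) / real n)"
    by (intro subadditive_convergent) (simp_all flip: of_nat_add)
  moreover have "tensor_exponent \<psi> = lim (\<lambda>n. real (log_rank \<psi> n) / real n)"
    unfolding tensor_exponent_def log_rank_def
    using restricts_to_unit_power_iff[of "tensor_power \<psi> _"] fin by simp
  ultimately show ?thesis by (simp add: convergent_LIMSEQ_iff)
qed

section \<open>Graph tensors\<close>

text \<open>
  The defining sum runs over labellings of all edges at once. It factors over the edges because the label
  of \<open>e\<close> only meets the entries \<open>x v e\<close> with \<open>v \<in> e\<close>. This form lets the edges of a power
  of \<open>T(K\<^sub>k)\<close> be redistributed among cliques.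
\<close>

lemma coeff_graph_tensor:
  assumes "finite_simple_graph G"
  shows "coeff (graph_tensor n G) x = (\<Prod>e\<in>snd G. \<Sum>c\<in>{1..n}. \<Prod>v\<in>e. basis_vec c (x v e))"
proof -
  have fin: "finite (fst G)" "finite (snd G)" and sub: "\<And>e. e \<in> snd G \<Longrightarrow> e \<subseteq> fst G"
    using assms finite_subset[OF _ finite_imp_finite_nsets]
    by (auto simp: finite_simple_graph_def nsets_def)
  have "(\<Prod>e\<in>snd G. \<Sum>c\<in>{1..n}. \<Prod>v\<in>e. basis_vec c (x v e)) =
      (\<Sum>i\<in>PiE (snd G) (\<lambda>_. {1..n}). \<Prod>e\<in>snd G. \<Prod>v\<in>e. basis_vec (i e) (x v e))"
    by (rule prod_sum_PiE) (use fin in auto)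
  also have "\<dots> = (\<Sum>i\<in>PiE (snd G) (\<lambda>_. {1..n}).
      \<Prod>e\<in>snd G. \<Prod>v\<in>{v \<in> fst G. v \<in> e}. basis_vec (i e) (x v e))"
    using sub by (intro sum.cong prod.cong refl) auto
  also have "\<dots> = (\<Sum>i\<in>PiE (snd G) (\<lambda>_. {1..n}).
      \<Prod>v\<in>fst G. \<Prod>e\<in>{e \<in> snd G. v \<in> e}. basis_vec (i e) (x v e))"
    by (intro sum.cong refl prod.swap_restrict fin)
  also have "\<dots> = coeff (graph_tensor n G) x"
    by (simp add: graph_tensor_def incident_edges_def)
  finally show ?thesis by simp
qed

text \<open>
  Each labelling of the edges contributes one product tensor to the defining sum.
\<close>

lemma rank_at_most_graph_tensor:
  assumes "finite_simple_graph G"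
  shows "rank_at_most (graph_tensor n G) (n ^ card (snd G))"
proof -
  have fin: "finite (snd G)"
    using assms finite_subset[OF _ finite_imp_finite_nsets] by (auto simp: finite_simple_graph_def)
  then have "rank_at_most (graph_tensor n G) (card (PiE (snd G) (\<lambda>_. {1..n})))"
    by (subst rank_at_most_card_iff)
       (auto intro!: finite_PiE exI[of _ "\<lambda>v a i. \<Prod>e\<in>incident_edges G v. basis_vec (i e) (a e)"]
          simp: graph_tensor_def)
  then show ?thesis using fin by (simp add: card_PiE)
qed

lemma card_nsets_superset:
  assumes "finite A" "e \<subseteq> A" "card e \<le> l"
  shows "card {S \<in> nsets A l. e \<subseteq> S} = (card A - card e) choose (l - card e)"
proof -
  have fe: "finite e" using assms finite_subset by blast
  have "bij_betw (\<lambda>S. S \<union> e) (nsets (A - e) (l - card e)) {S \<in> nsets A l. e \<subseteq> S}"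
  proof (rule bij_betw_byWitness[where f' = "\<lambda>S. S - e"])
    show "(\<lambda>S. S \<union> e) ` nsets (A - e) (l - card e) \<subseteq> {S \<in> nsets A l. e \<subseteq> S}"
      using assms fe by (auto simp: nsets_def card_Un_disjoint Diff_eq disjoint_iff subset_eq)
    show "(\<lambda>S. S - e) ` {S \<in> nsets A l. e \<subseteq> S} \<subseteq> nsets (A - e) (l - card e)"
      using fe by (auto simp: nsets_def card_Diff_subset)
  qed (auto simp: nsets_def)
  from bij_betw_same_card[OF this] show ?thesis
    using assms fe by (simp add: card_Diff_subset)
qed

text \<open>
  In the power \<open>c N\<close> every edge \<open>e\<close> of \<open>K\<^sub>k\<close> occurs \<open>c N\<close> times, once for each position. The
  bijection \<open>b e\<close> assigns these occurrences to the pairs \<open>(S, s)\<close> of an \<open>l\<close>-set \<open>S \<supseteq> e\<close> and a position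
  \<open>s < N\<close>, that is, to the occurrences of \<open>e\<close> in the clique tensors, separately for each edge.
\<close>

lemma rank_complete_graph_from_cliques:
  assumes l: "2 \<le> l"
    and rank: "rank_at_most (tensor_power (graph_tensor d (complete_graph l)) N) r"
  shows "rank_at_most (tensor_power (graph_tensor d (complete_graph k)) (((k - 2) choose (l - 2)) * N))
           (r ^ (k choose l))"
proof -
  define c where "c = (k - 2) choose (l - 2)"
  define J where "J = nsets {1..k} l"
  have finJ: "finite J" by (simp add: J_def finite_imp_finite_nsets)
  have "\<forall>S\<in>J. \<exists>\<sigma>. bij_betw \<sigma> {1..l} S"
    unfolding J_def nsets_def by (auto intro!: finite_same_card_bij)
  then obtain \<sigma> where \<sigma>: "\<And>S. S \<in> J \<Longrightarrow> bij_betw (\<sigma> S) {1..l} S" by metis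
  have "\<forall>e\<in>nsets {1..k} 2. \<exists>b. bij_betw b ({S \<in> J. e \<subseteq> S} \<times> {..<N}) {..<c * N}"
  proof
    fix e assume e: "e \<in> nsets {1..k} 2"
    then have "card {S \<in> J. e \<subseteq> S} = c"
      using card_nsets_superset[of "{1..k}" e l] l by (simp add: nsets_def J_def c_def)
    then show "\<exists>b. bij_betw b ({S \<in> J. e \<subseteq> S} \<times> {..<N}) {..<c * N}"
      using finJ by (intro finite_same_card_bij) (auto simp: card_cartesian_product)
  qed
  from bchoice[OF this] obtain b where b: "\<And>e. e \<in> nsets {1..k} 2 \<Longrightarrow>
      bij_betw (b e) ({S \<in> J. e \<subseteq> S} \<times> {..<N}) {..<c * N}"
    by blast
  have edge: "\<sigma> S ` e \<in> nsets {1..k} 2" "\<sigma> S ` e \<subseteq> S" "inj_on (\<sigma> S) e"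
    if "S \<in> J" "e \<in> nsets {1..l} 2" for S e
  proof -
    have "\<sigma> S ` e \<in> nsets S 2"
      using bij_betw_nsets[OF \<sigma>[OF that(1)]] that(2) by (auto simp: bij_betw_def)
    then show "\<sigma> S ` e \<in> nsets {1..k} 2" "\<sigma> S ` e \<subseteq> S"
      using that(1) by (auto simp: nsets_def J_def)
    show "inj_on (\<sigma> S) e"
      using \<sigma>[OF that(1)] that(2) by (auto simp: bij_betw_def nsets_def intro: inj_on_subset)
  qed
  have bin: "b (\<sigma> S ` e) (S, s) < c * N" if "S \<in> J" "e \<in> nsets {1..l} 2" "s < N" for S e s
    using bij_betwE[OF b[OF edge(1)[OF that(1,2)]]] that edge by auto
  \<comment> \<open>The part of a basis index on leg \<open>\<sigma> S u\<close> that belongs to the clique \<open>S\<close>, with vertices and edges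
      renamed along \<open>\<sigma> S\<close>.\<close>
  define g where "g S u a = (\<lambda>s\<in>{..<N}. \<lambda>e\<in>incident_edges (complete_graph l) u.
      a (b (\<sigma> S ` e) (S, s)) (\<sigma> S ` e))"
    for S u and a :: "nat \<Rightarrow> nat set \<Rightarrow> nat"
  let ?K = "\<lambda>m. graph_tensor d (complete_graph m)"
  have "rank_at_most (tensor_power (?K k) (c * N)) (\<Prod>S\<in>J. r)"
  proof (rule rank_at_most_prod[where \<phi> = "\<lambda>_. tensor_power (?K l) N" and h = \<sigma> and g = g])
    show "finite J" by (rule finJ)
    show "finite (legs (tensor_power (?K k) (c * N)))"
      by (simp add: graph_tensor_def complete_graph_def)
    show "rank_at_most (tensor_power (?K l) N) r" by (rule rank)
  next
    fix S assume S: "S \<in> J"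
    show "inj_on (\<sigma> S) (legs (tensor_power (?K l) N))"
      using \<sigma>[OF S] by (simp add: graph_tensor_def complete_graph_def bij_betw_def)
    show "\<sigma> S ` legs (tensor_power (?K l) N) \<subseteq> legs (tensor_power (?K k) (c * N))"
      using \<sigma>[OF S] S by (auto simp: graph_tensor_def complete_graph_def bij_betw_def J_def nsets_def)
    fix u a
    assume a: "a \<in> idx (tensor_power (?K k) (c * N)) (\<sigma> S u)"
    show "g S u a \<in> idx (tensor_power (?K l) N) u"
    proof -
      have "a (b (\<sigma> S ` e) (S, s)) (\<sigma> S ` e) \<in> {1..d}"
        if "s < N" "e \<in> nsets {1..l} 2" "u \<in> e" for s e
      proof -
        have "a (b (\<sigma> S ` e) (S, s)) \<in> PiE (incident_edges (complete_graph k) (\<sigma> S u)) (\<lambda>_. {1..d})"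
          using a bin[OF S that(2,1)] by (auto simp: tensor_power_def graph_tensor_def)
        moreover have "\<sigma> S ` e \<in> incident_edges (complete_graph k) (\<sigma> S u)"
          using edge(1)[OF S that(2)] that(3) by (auto simp: incident_edges_def complete_graph_def)
        ultimately show ?thesis by blast
      qed
      then show ?thesis
        by (auto simp: g_def tensor_power_def graph_tensor_def incident_edges_def complete_graph_def)
    qed
  next
    fix y :: "nat \<Rightarrow> nat \<Rightarrow> nat set \<Rightarrow> nat"
    \<comment> \<open>\<open>W s e\<close> is the factor of edge \<open>e\<close> at position \<open>s\<close>; both sides are products of these factors.\<close>
    define W where "W s e = (\<Sum>i\<in>{1..d}. \<Prod>v\<in>e. basis_vec i (y v s e))" for s e
    have coeff_K: "coeff (?K m) x =
        (\<Prod>e\<in>nsets {1..m} 2. \<Sum>i\<in>{1..d}. \<Prod>v\<in>e. basis_vec i (x v e))" for m x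
      using coeff_graph_tensor[OF finite_simple_graph_complete_graph, of d m x]
      by (simp add: complete_graph_def)
    have factor: "coeff (tensor_power (?K l) N)
          (\<lambda>u\<in>legs (tensor_power (?K l) N). g S u (y (\<sigma> S u))) =
        (\<Prod>e\<in>{e \<in> nsets {1..k} 2. e \<subseteq> S}. \<Prod>s<N. W (b e (S, s)) e)" if S: "S \<in> J" for S
    proof -
      have "coeff (tensor_power (?K l) N)
          (\<lambda>u\<in>legs (tensor_power (?K l) N). g S u (y (\<sigma> S u))) =
        (\<Prod>s<N. \<Prod>e\<in>nsets {1..l} 2. \<Sum>i\<in>{1..d}. \<Prod>u\<in>e.
          basis_vec i (y (\<sigma> S u) (b (\<sigma> S ` e) (S, s)) (\<sigma> S ` e)))"
        unfolding tensor_power_def tensor.select_convs coeff_K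
        by (intro prod.cong sum.cong refl)
           (auto simp: g_def graph_tensor_def incident_edges_def complete_graph_def nsets_def)
      also have "\<dots> = (\<Prod>s<N. \<Prod>e\<in>nsets {1..l} 2. W (b (\<sigma> S ` e) (S, s)) (\<sigma> S ` e))"
        by (intro prod.cong refl) (simp add: W_def prod.reindex edge(3)[OF S])
      also have "\<dots> = (\<Prod>s<N. \<Prod>e\<in>nsets S 2. W (b e (S, s)) e)"
        by (intro prod.cong refl prod.reindex_bij_betw[OF bij_betw_nsets[OF \<sigma>[OF S]]])
      also have "nsets S 2 = {e \<in> nsets {1..k} 2. e \<subseteq> S}"
        using S by (auto simp: nsets_def J_def)
      finally show ?thesis by (simp only: prod.swap[of _ _ "{..<N}"])
    qed
    have "(\<Prod>S\<in>J. coeff (tensor_power (?K l) N)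
          (\<lambda>u\<in>legs (tensor_power (?K l) N). g S u (y (\<sigma> S u)))) =
        (\<Prod>S\<in>J. \<Prod>e\<in>{e \<in> nsets {1..k} 2. e \<subseteq> S}. \<Prod>s<N. W (b e (S, s)) e)"
      by (intro prod.cong refl factor)
    also have "\<dots> = (\<Prod>e\<in>nsets {1..k} 2. \<Prod>S\<in>{S \<in> J. e \<subseteq> S}. \<Prod>s<N. W (b e (S, s)) e)"
      by (rule prod.swap_restrict) (simp_all add: finJ finite_imp_finite_nsets)
    also have "\<dots> = (\<Prod>e\<in>nsets {1..k} 2. \<Prod>p\<in>{S \<in> J. e \<subseteq> S} \<times> {..<N}. W (b e p) e)"
      by (simp add: prod.cartesian_product case_prod_unfold)
    also have "\<dots> = (\<Prod>e\<in>nsets {1..k} 2. \<Prod>s<c * N. W s e)"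
      by (intro prod.cong refl prod.reindex_bij_betw[OF b])
    also have "\<dots> = (\<Prod>s<c * N. \<Prod>e\<in>nsets {1..k} 2. W s e)"
      by (rule prod.swap)
    also have "\<dots> = coeff (tensor_power (?K k) (c * N)) y"
      unfolding tensor_power_def tensor.select_convs coeff_K W_def
      by (intro prod.cong sum.cong refl)
         (auto simp: graph_tensor_def complete_graph_def nsets_def)
    finally show "coeff (tensor_power (?K k) (c * N)) y = (\<Prod>S\<in>J. coeff (tensor_power (?K l) N)
          (\<lambda>u\<in>legs (tensor_power (?K l) N). g S u (y (\<sigma> S u))))"
      by simp
  qed
  then show ?thesis by (simp add: c_def J_def)
qed

theorem proposition1p1p25:
  fixes k l :: nat
  assumes "k \<ge> l" and "l \<ge> 2"
  shows "exponent_per_edge (complete_graph k) \<le> exponent_per_edge (complete_graph l)"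
proof -
  let ?K = "\<lambda>m. graph_tensor 2 (complete_graph m)"
  define c where "c = (k - 2) choose (l - 2)"
  have c: "c > 0" using assms by (simp add: c_def)
  have edges: "0 < l choose 2" "0 < k choose 2"
    using assms by simp_all
  have fin: "finite (legs (?K m))" for m
    by (simp add: graph_tensor_def complete_graph_def)
  have rank: "rank_at_most (?K m) (2 ^ card (snd (complete_graph m)))" for m
    by (rule rank_at_most_graph_tensor[OF finite_simple_graph_complete_graph])
  have lim: "(\<lambda>n. real (log_rank (?K m) n) / real n) \<longlonglongrightarrow> tensor_exponent (?K m)" for m
    by (rule tensor_exponent_limit[OF fin rank])
  have step: "real (log_rank (?K k) (c * n)) / real (c * n) \<le>
      real (k choose l) / real c * (real (log_rank (?K l) n) / real n)" for n
  proof -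
    have "rank_at_most (tensor_power (?K k) (c * n)) ((2 ^ log_rank (?K l) n) ^ (k choose l))"
      unfolding c_def
      by (rule rank_complete_graph_from_cliques[OF assms(2) rank_at_most_log_rank[OF fin rank]])
    then have "log_rank (?K k) (c * n) \<le> (k choose l) * log_rank (?K l) n"
      by (intro log_rank_le) (simp add: power_mult[symmetric] mult.commute)
    then have "real (log_rank (?K k) (c * n)) \<le> real (k choose l) * real (log_rank (?K l) n)"
      by (simp flip: of_nat_mult)
    then show ?thesis by (simp add: divide_right_mono)
  qed
  have "strict_mono (\<lambda>n. c * n)" using c by (simp add: strict_mono_def)
  from LIMSEQ_subseq_LIMSEQ[OF lim[of k] this]
  have "(\<lambda>n. real (log_rank (?K k) (c * n)) / real (c * n)) \<longlonglongrightarrow> tensor_exponent (?K k)"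
    by (simp add: o_def)
  then have "tensor_exponent (?K k) \<le> real (k choose l) / real c * tensor_exponent (?K l)"
    by (rule LIMSEQ_le[OF _ tendsto_mult_left[OF lim[of l]]]) (use step in auto)
  also have "real (k choose l) / real c = real (k choose 2) / real (l choose 2)"
  proof -
    have "real (k choose l) * real (l choose 2) = real (k choose 2) * real c"
      using choose_mult[of 2 l k] assms by (simp add: c_def flip: of_nat_mult)
    then show ?thesis using c edges by (simp add: frac_eq_eq)
  qed
  finally show ?thesis
    using edges by (simp add: exponent_per_edge_def complete_graph_def field_simps)
qed

end
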